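(* Let $x_L<x_R$ and $a>0$ be real numbers, let $\mathbf{x}=[x_1,\dots,x_N]^T$ be grid points in $[x_L,x_R]$ with $x_1=x_L$ and $x_N=x_R$, let $\mathcal{F}\subset C^1([x_L,x_R])$ be a finite-dimensional function space, and let $D=P^{-1}Q$ be an $\mathcal{F}$-based SBP operator on $\mathbf{x}$ with diagonal norm matrix $P$. For $\sigma\in\mathbb{R}$ and boundary data $g=g(t)$, consider the FSBP-SAT semi-discretization $$\mathbf{u}_t + a D\mathbf{u} = P^{-1}\mathbb{S},\qquad \mathbb{S}=[\mathbb{S}_1,0,\dots,0]^T,\qquad \mathbb{S}_1=-\sigma a\,(u_1-g),$$ of the linear advection equation $\partial_t u + a\,\partial_x u=0$ on $(x_L,x_R)$, $t>0$, with $u(0,x)=u_0(x)$ and $u(t,x_L)=g(t)$, where $\mathbf{u}(t)=[u_1(t),\dots,u_N(t)]^T$. This semi-discretization is (1) conservative if $\mathcal{F}$ contains the constants; (2) energy-stable if $\sigma>1/2$.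
   Context: For $f\in C^1([x_L,x_R])$ write $f(\mathbf{x})=[f(x_1),\dots,f(x_N)]^T$ and $f'(\mathbf{x})=[f'(x_1),\dots,f'(x_N)]^T$. $\mathcal{F}$-based SBP (summation-by-parts) operator: a real $N\times N$ matrix $D=P^{-1}Q$, with $P,Q\in\mathbb{R}^{N\times N}$, such that (i) $Df(\mathbf{x})=f'(\mathbf{x})$ for all $f\in\mathcal{F}$; (ii) $P$ (the norm matrix) is symmetric positive definite; (iii) $Q+Q^T=B:=\operatorname{diag}(-1,0,\dots,0,1)$. Write $\mathbf{1}=[1,\dots,1]^T\in\mathbb{R}^N$ and $\|\mathbf{u}\|_P^2=\mathbf{u}^TP\mathbf{u}$. Conservative means that the discrete total amount $\mathbf{1}^TP\mathbf{u}$ changes only through boundary terms, mimicking $\frac{d}{dt}\int_{x_L}^{x_R}u\,dx=-a[u(t,x_R)-g(t)]$: every solution $\mathbf{u}$ of the semi-discretization satisfies $$\mathbf{1}^TP\mathbf{u}_t=-a\big[u_N-\big(\sigma g(t)+(1-\sigma)u_1\big)\big],$$ which for $\sigma=1$ reads $\mathbf{1}^TP\mathbf{u}_t=-a[u_N-g(t)]$. Energy-stable means that the growth of the discrete energy is bounded in terms of the boundary data, mimicking $\frac{d}{dt}\|u\|_{L^2}^2\le a\,g(t)^2$: every solution $\mathbf{u}$ of the semi-discretization satisfies $$\frac{d}{dt}\|\mathbf{u}\|_P^2\le a\,g(t)^2\,\frac{\sigma^2}{2\sigma-1}.$$ *)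

theory Defs
  imports "HOL-Analysis.Analysis" "HOL-Library.Function_Algebras"
begin

text \<open>
  Vectors and matrices of size \<open>N\<close> are indexed by a finite linearly ordered type \<open>'n\<close> with
  \<open>N = CARD('n)\<close>; the grid indices \<open>1\<close> and \<open>N\<close> are its least and greatest elements.
\<close>

type_synonym 'n rvec = "(real, 'n) vec"
type_synonym 'n rmat = "((real, 'n) vec, 'n) vec"

definition idx_first :: "'n::{finite,linorder}" where
  "idx_first = Min UNIV"

definition idx_last :: "'n::{finite,linorder}" where
  "idx_last = Max UNIV"

interpretation real_fun: vector_space "\<lambda>(c::real) (f::real \<Rightarrow> real) x. c * f x"
  by unfold_locales (auto simp: fun_eq_iff algebra_simps)

text \<open>
  Functions on \<open>[a, b]\<close> are represented by total functions whose values outside \<open>[a, b]\<close> are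
  irrelevant; derivatives at the end points are one-sided.
\<close>

definition deriv_on :: "real \<Rightarrow> real \<Rightarrow> (real \<Rightarrow> real) \<Rightarrow> real \<Rightarrow> real" where
  "deriv_on a b f x = vector_derivative f (at x within {a..b})"

definition C1_functions :: "real \<Rightarrow> real \<Rightarrow> (real \<Rightarrow> real) set" where
  "C1_functions a b = {f. f differentiable_on {a..b} \<and> continuous_on {a..b} (deriv_on a b f)}"

definition finite_dim_function_space :: "(real \<Rightarrow> real) set \<Rightarrow> bool" where
  "finite_dim_function_space F \<longleftrightarrow>
     real_fun.subspace F \<and> (\<exists>B. finite B \<and> real_fun.span B = F)"

definition contains_constants :: "real \<Rightarrow> real \<Rightarrow> (real \<Rightarrow> real) set \<Rightarrow> bool" where
  "contains_constants a b F \<longleftrightarrow> (\<forall>c. \<exists>f\<in>F. \<forall>x\<in>{a..b}. f x = c)"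

definition grid_eval :: "(real \<Rightarrow> real) \<Rightarrow> 'n::finite rvec \<Rightarrow> 'n rvec" where
  "grid_eval f x = (\<chi> i. f (x $ i))"

definition is_grid :: "real \<Rightarrow> real \<Rightarrow> 'n::{finite,linorder} rvec \<Rightarrow> bool" where
  "is_grid a b x \<longleftrightarrow>
     (\<forall>i. x $ i \<in> {a..b}) \<and> x $ idx_first = a \<and> x $ idx_last = b"

definition diagonal_matrix :: "'n::finite rmat \<Rightarrow> bool" where
  "diagonal_matrix A \<longleftrightarrow> (\<forall>i j. i \<noteq> j \<longrightarrow> A $ i $ j = 0)"

definition sym_pos_def :: "'n::finite rmat \<Rightarrow> bool" where
  "sym_pos_def A \<longleftrightarrow> transpose A = A \<and> (\<forall>v. v \<noteq> 0 \<longrightarrow> 0 < v \<bullet> (A *v v))"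

definition boundary_matrix :: "'n::{finite,linorder} rmat" where
  "boundary_matrix = (\<chi> i j. if i = j \<and> i = idx_first then - 1
                             else if i = j \<and> i = idx_last then 1 else 0)"

definition fsbp_operator ::
  "real \<Rightarrow> real \<Rightarrow> (real \<Rightarrow> real) set \<Rightarrow> 'n::{finite,linorder} rvec \<Rightarrow>
   'n rmat \<Rightarrow> 'n rmat \<Rightarrow> 'n rmat \<Rightarrow> bool" where
  "fsbp_operator a b F x D P Q \<longleftrightarrow>
     D = matrix_inv P ** Q \<and>
     (\<forall>f\<in>F. D *v grid_eval f x = grid_eval (deriv_on a b f) x) \<and>
     sym_pos_def P \<and>
     Q + transpose Q = boundary_matrix"

definition SAT ::
  "real \<Rightarrow> real \<Rightarrow> real \<Rightarrow> 'n::{finite,linorder} rvec \<Rightarrow> 'n rvec" where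
  "SAT a \<sigma> gt v = (\<chi> i. if i = idx_first then - \<sigma> * a * (v $ idx_first - gt) else 0)"

definition semidiscrete_solution ::
  "real \<Rightarrow> real \<Rightarrow> (real \<Rightarrow> real) \<Rightarrow> (real \<Rightarrow> real) \<Rightarrow> 'n::{finite,linorder} rvec \<Rightarrow>
   'n rmat \<Rightarrow> 'n rmat \<Rightarrow> (real \<Rightarrow> 'n rvec) \<Rightarrow> bool" where
  "semidiscrete_solution a \<sigma> g u0 x D P u \<longleftrightarrow>
     continuous_on {0..} u \<and> u 0 = grid_eval u0 x \<and>
     (\<forall>t>0. u differentiable at t \<and>
        vector_derivative u (at t) + a *\<^sub>R (D *v u t) = matrix_inv P *v SAT a \<sigma> (g t) (u t))"

definition conservative ::
  "real \<Rightarrow> real \<Rightarrow> (real \<Rightarrow> real) \<Rightarrow> (real \<Rightarrow> real) \<Rightarrow> 'n::{finite,linorder} rvec \<Rightarrow>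
   'n rmat \<Rightarrow> 'n rmat \<Rightarrow> bool" where
  "conservative a \<sigma> g u0 x D P \<longleftrightarrow>
     (\<forall>u. semidiscrete_solution a \<sigma> g u0 x D P u \<longrightarrow>
       (\<forall>t>0. vec 1 \<bullet> (P *v vector_derivative u (at t)) =
          - a * (u t $ idx_last - (\<sigma> * g t + (1 - \<sigma>) * u t $ idx_first))))"

definition P_norm_sq :: "'n::finite rmat \<Rightarrow> 'n rvec \<Rightarrow> real" where
  "P_norm_sq P v = v \<bullet> (P *v v)"

definition energy_stable ::
  "real \<Rightarrow> real \<Rightarrow> (real \<Rightarrow> real) \<Rightarrow> (real \<Rightarrow> real) \<Rightarrow> 'n::{finite,linorder} rvec \<Rightarrow>
   'n rmat \<Rightarrow> 'n rmat \<Rightarrow> bool" where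
  "energy_stable a \<sigma> g u0 x D P \<longleftrightarrow>
     (\<forall>u. semidiscrete_solution a \<sigma> g u0 x D P u \<longrightarrow>
       (\<forall>t>0. \<exists>E'. ((\<lambda>s. P_norm_sq P (u s)) has_real_derivative E') (at t) \<and>
          E' \<le> a * (g t)\<^sup>2 * (\<sigma>\<^sup>2 / (2 * \<sigma> - 1))))"

end

theory Submission
  imports Defs
begin

text \<open>
  Multiplied by \<open>P\<close>, the scheme reads \<open>P u\<^sub>t = - a Q u + S\<close>. Both claims follow by pairing this
  with a vector and using \<open>Q + Q\<^sup>T = B\<close>. Pairing with \<open>1\<close> gives
  \<open>1 \<bullet> Q u = 1 \<bullet> B u - Q 1 \<bullet> u\<close>, where \<open>Q 1 = P D 1 = 0\<close> because \<open>D\<close> differentiates constants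
  exactly. Pairing with \<open>2 u\<close> gives
  \<open>- a u\<^sub>N\<^sup>2 + a u\<^sub>1\<^sup>2 - 2 \<sigma> a u\<^sub>1 (u\<^sub>1 - g)\<close>, in which one completes the square in \<open>u\<^sub>1\<close>.
\<close>

lemma sym_pos_def_imp_invertible:
  assumes "sym_pos_def (P :: 'n::finite rmat)"
  shows "invertible P"
proof -
  have "v = 0" if "P *v v = 0" for v
    using assms that unfolding sym_pos_def_def by (metis inner_zero_right less_irrefl)
  then show ?thesis
    by (simp add: invertible_left_inverse matrix_left_invertible_ker)
qed

lemma sym_pos_def_inner_commute:
  assumes "sym_pos_def (P :: 'n::finite rmat)"
  shows "v \<bullet> (P *v w) = w \<bullet> (P *v v)"
  using assms unfolding sym_pos_def_def
  by (metis dot_lmul_matrix inner_commute transpose_matrix_vector)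

text \<open>Discrete integration by parts: for \<open>A = Q\<close> the symmetric part on the right
  is \<open>boundary_matrix\<close>, so only boundary values remain.\<close>

lemma inner_transpose_mult:
  fixes A :: "'n::finite rmat"
  shows "v \<bullet> (A *v w) + w \<bullet> (A *v v) = v \<bullet> ((A + transpose A) *v w)"
  by (metis dot_lmul_matrix inner_add_right inner_commute matrix_vector_mult_add_rdistrib
      transpose_matrix_vector)

text \<open>On a single index the first branch of \<open>boundary_matrix\<close> would win and leave
  the entry -1, while the right-hand side would vanish; hence the assumption.\<close>

lemma inner_boundary_matrix:
  fixes v w :: "'n::{finite,linorder} rvec"
  assumes "(idx_first :: 'n) \<noteq> idx_last"
  shows "v \<bullet> (boundary_matrix *v w)
    = v $ idx_last * w $ idx_last - v $ idx_first * w $ idx_first"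
proof -
  \<comment> \<open>A difference of two one-point indicators replaces the nested conditional, so
    that the sum over \<open>i\<close> splits into two sums with one nonzero term each.\<close>
  have component: "(boundary_matrix *v w) $ i
      = (if i = idx_last then w $ idx_last else 0) - (if i = idx_first then w $ idx_first else 0)"
    (is "_ = ?b i") for i
  proof -
    have "boundary_matrix $ i $ j * w $ j = (if j = i then ?b i else 0)" for j
      using assms by (auto simp: boundary_matrix_def)
    then show ?thesis
      by (simp add: matrix_vector_mult_def)
  qed
  have "v \<bullet> (boundary_matrix *v w)
      = (\<Sum>i::'n\<in>UNIV. (if i = idx_last then v $ idx_last * w $ idx_last else 0)
          - (if i = idx_first then v $ idx_first * w $ idx_first else 0))"
    unfolding inner_vec_def by (intro sum.cong) (auto simp: component right_diff_distrib)
  then show ?thesis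
    by (simp add: sum_subtractf)
qed

lemma inner_SAT:
  fixes v w :: "'n::{finite,linorder} rvec"
  shows "v \<bullet> SAT a \<sigma> gt w = - \<sigma> * a * (w $ idx_first - gt) * v $ idx_first"
proof -
  have "v \<bullet> SAT a \<sigma> gt w
      = (\<Sum>i::'n\<in>UNIV. if i = idx_first then - \<sigma> * a * (w $ idx_first - gt) * v $ idx_first else 0)"
    unfolding inner_vec_def SAT_def by (intro sum.cong) auto
  then show ?thesis by simp
qed

lemma is_grid_idx_neq:
  fixes x :: "'n::{finite,linorder} rvec"
  assumes "is_grid a b x" and "a < b"
  shows "(idx_first :: 'n) \<noteq> idx_last"
  using assms unfolding is_grid_def by force

text \<open>\<open>matrix_inv\<close> is a choice and cancels only against an invertible matrix;
  positive definiteness of \<open>P\<close> provides this.\<close>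

lemma fsbp_operator_norm_mult:
  assumes "fsbp_operator a b F x D P (Q :: 'n::{finite,linorder} rmat)"
  shows "P ** D = Q" and "P ** matrix_inv P = mat 1"
proof -
  show *: "P ** matrix_inv P = mat 1"
    using assms sym_pos_def_imp_invertible unfolding fsbp_operator_def invertible_def matrix_inv_def
    by (metis (mono_tags, lifting) someI_ex)
  then show "P ** D = Q"
    using assms by (simp add: fsbp_operator_def matrix_mul_assoc)
qed

lemma fsbp_operator_ones:
  fixes x :: "'n::{finite,linorder} rvec"
  assumes "fsbp_operator a b F x D P Q" and "a < b" and "is_grid a b x"
    and "contains_constants a b F"
  shows "Q *v vec 1 = 0"
proof -
  obtain f where f: "f \<in> F" "\<And>y. y \<in> {a..b} \<Longrightarrow> f y = 1"
    using assms(4) unfolding contains_constants_def by blast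
  have grid: "x $ i \<in> {a..b}" for i
    using assms(3) by (simp add: is_grid_def)
  have "deriv_on a b f y = 0" if "y \<in> {a..b}" for y
  proof -
    have "((\<lambda>_. 1) has_vector_derivative 0) (at y within {a..b})"
      by (rule has_vector_derivative_const)
    \<comment> \<open>\<open>f\<close> equals 1 only on the interval, so the derivative has to be
      taken within it.\<close>
    then have "(f has_vector_derivative 0) (at y within {a..b})"
      by (rule has_vector_derivative_transform[rotated 2]) (use f that in auto)
    \<comment> \<open>\<open>a < b\<close> makes the one-sided derivative unique, so
      \<open>vector_derivative\<close> can only pick 0.\<close>
    then show ?thesis
      using assms(2) that vector_derivative_within_cbox[of a b y f 0] by (simp add: deriv_on_def)
  qed
  then have "grid_eval (deriv_on a b f) x = 0"
    using grid by (simp add: grid_eval_def vec_eq_iff)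
  moreover have "grid_eval f x = vec 1"
    using grid f by (simp add: grid_eval_def vec_eq_iff)
  ultimately have "D *v vec 1 = 0"
    using assms(1) f(1) by (metis fsbp_operator_def)
  then show ?thesis
    using fsbp_operator_norm_mult(1)[OF assms(1)]
    by (metis matrix_vector_mul_assoc matrix_vector_mult_0_right)
qed

lemma semidiscrete_solution_norm_mult:
  fixes x :: "'n::{finite,linorder} rvec"
  assumes "fsbp_operator xl xr F x D P Q" and "semidiscrete_solution a \<sigma> g u0 x D P u" and "t > 0"
  shows "P *v vector_derivative u (at t) = SAT a \<sigma> (g t) (u t) - a *\<^sub>R (Q *v u t)"
proof -
  have "vector_derivative u (at t) = matrix_inv P *v SAT a \<sigma> (g t) (u t) - a *\<^sub>R (D *v u t)"
    using assms(2,3) unfolding semidiscrete_solution_def by (metis add_diff_cancel_right')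
  then show ?thesis
    using fsbp_operator_norm_mult[OF assms(1)]
    by (simp add: matrix_vector_mult_diff_distrib matrix_vector_mult_scaleR matrix_vector_mul_assoc)
qed

text \<open>The product rule gives two terms, which symmetry of \<open>P\<close> makes
  equal.\<close>

lemma P_norm_sq_has_real_derivative:
  assumes "sym_pos_def (P :: 'n::finite rmat)" and "(u has_vector_derivative u') (at t)"
  shows "((\<lambda>s. P_norm_sq P (u s)) has_real_derivative 2 * (u t \<bullet> (P *v u'))) (at t)"
proof -
  have "((\<lambda>s. P *v u s) has_vector_derivative P *v u') (at t)"
    using bounded_linear.has_vector_derivative[OF matrix_vector_mul_bounded_linear assms(2)] .
  from bounded_bilinear.has_vector_derivative[OF bounded_bilinear_inner assms(2) this]
  have "((\<lambda>s. u s \<bullet> (P *v u s)) has_vector_derivative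
      u t \<bullet> (P *v u') + u' \<bullet> (P *v u t)) (at t)" .
  then show ?thesis
    using sym_pos_def_inner_commute[OF assms(1), of u' "u t"]
    by (simp add: P_norm_sq_def has_real_derivative_iff_has_vector_derivative)
qed

text \<open>Here \<open>v\<close> and \<open>w\<close> stand for the first and last components of
  the solution. With \<open>c = 2 * \<sigma> - 1 > 0\<close>, the left side is a concave quadratic
  in \<open>v\<close> with its maximum at \<open>v = \<sigma> * g / c\<close>; the term in
  \<open>w\<close> only lowers it.\<close>

lemma energy_rate_le:
  fixes a \<sigma> g v w :: real
  assumes "a > 0" and "\<sigma> > 1 / 2"
  shows "- a * (w\<^sup>2 - v\<^sup>2) - 2 * \<sigma> * a * (v - g) * v \<le> a * g\<^sup>2 * (\<sigma>\<^sup>2 / (2 * \<sigma> - 1))"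
proof -
  define c where "c = 2 * \<sigma> - 1"
  have c: "c > 0" and \<sigma>: "\<sigma> = (c + 1) / 2"
    using assms by (auto simp: c_def)
  \<comment> \<open>Eliminating \<open>\<sigma>\<close> in favour of \<open>c\<close> leaves a
    rational identity in which \<open>c\<close> is the only variable denominator.\<close>
  have "a * g\<^sup>2 * (\<sigma>\<^sup>2 / c) - (- a * (w\<^sup>2 - v\<^sup>2) - 2 * \<sigma> * a * (v - g) * v)
      = a * w\<^sup>2 + a * (c * v - \<sigma> * g)\<^sup>2 / c"
    using c unfolding \<sigma> by (simp add: field_simps power2_eq_square)
  also have "\<dots> \<ge> 0"
    using c assms by simp
  finally show ?thesis
    by (simp add: c_def)
qed

theorem theorem3p1:
  fixes x_L x_R a \<sigma> :: real
    and x :: "'n::{finite,linorder} rvec"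
    and F :: "(real \<Rightarrow> real) set"
    and D P Q :: "'n rmat"
    and g u0 :: "real \<Rightarrow> real"
  assumes "x_L < x_R" and "a > 0"
    and "is_grid x_L x_R x"
    and "finite_dim_function_space F" and "F \<subseteq> C1_functions x_L x_R"
    and "fsbp_operator x_L x_R F x D P Q"
    and "diagonal_matrix P"
  shows "(contains_constants x_L x_R F \<longrightarrow> conservative a \<sigma> g u0 x D P) \<and>
         (\<sigma> > 1 / 2 \<longrightarrow> energy_stable a \<sigma> g u0 x D P)"
proof (intro conjI impI)
  have spd: "sym_pos_def P" and B: "Q + transpose Q = boundary_matrix"
    using assms(6) by (auto simp: fsbp_operator_def)
  \<comment> \<open>Used with \<open>v = 1\<close> for conservation and with \<open>v = w\<close>
    for the energy.\<close>
  have sbp: "v \<bullet> (Q *v w) + w \<bullet> (Q *v v)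
      = v $ idx_last * w $ idx_last - v $ idx_first * w $ idx_first" for v w
    using inner_transpose_mult[of v Q w] inner_boundary_matrix is_grid_idx_neq[OF assms(3,1)] B
    by simp
  note scheme = semidiscrete_solution_norm_mult[OF assms(6)]
  {
    assume "contains_constants x_L x_R F"
    then have "Q *v vec 1 = 0"
      using assms(1,3,6) fsbp_operator_ones by blast
    then have ones: "1 \<bullet> (Q *v w) = w $ idx_last - w $ idx_first" for w
      using sbp[of 1 w] by simp
    then show "conservative a \<sigma> g u0 x D P"
      unfolding conservative_def
      \<comment> \<open>The flux contributes \<open>a * u_1\<close> and the SAT term
        \<open>- \<sigma> * a * (u_1 - g)\<close>; together they give the weighted inflow value
        \<open>\<sigma> * g + (1 - \<sigma>) * u_1\<close>, times \<open>a\<close>.\<close>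
      by (auto simp: scheme inner_diff_right inner_SAT ones) (simp add: algebra_simps)
  next
    assume "\<sigma> > 1 / 2"
    show "energy_stable a \<sigma> g u0 x D P"
      unfolding energy_stable_def
    proof (intro allI impI)
      fix u and t :: real
      assume u: "semidiscrete_solution a \<sigma> g u0 x D P u" and "t > 0"
      let ?u' = "vector_derivative u (at t)"
      have "(u has_vector_derivative ?u') (at t)"
        using u \<open>t > 0\<close> by (simp add: semidiscrete_solution_def vector_derivative_works[symmetric])
      then have deriv: "((\<lambda>s. P_norm_sq P (u s)) has_real_derivative 2 * (u t \<bullet> (P *v ?u'))) (at t)"
        by (rule P_norm_sq_has_real_derivative[OF spd])
      have "2 * (u t \<bullet> (P *v ?u')) = - a * ((u t $ idx_last)\<^sup>2 - (u t $ idx_first)\<^sup>2)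
          - 2 * \<sigma> * a * (u t $ idx_first - g t) * u t $ idx_first"
      proof -
        have *: "2 * (u t \<bullet> (Q *v u t)) = (u t $ idx_last)\<^sup>2 - (u t $ idx_first)\<^sup>2"
          using sbp[of "u t" "u t"] by (simp add: power2_eq_square)
        have "2 * (u t \<bullet> (P *v ?u')) = 2 * (u t \<bullet> SAT a \<sigma> (g t) (u t)) - a * (2 * (u t \<bullet> (Q *v u t)))"
          by (simp add: scheme[OF u \<open>t > 0\<close>] inner_diff_right)
        then show ?thesis
          unfolding * inner_SAT by (simp add: algebra_simps)
      qed
      also have "\<dots> \<le> a * (g t)\<^sup>2 * (\<sigma>\<^sup>2 / (2 * \<sigma> - 1))"
        by (rule energy_rate_le[OF \<open>a > 0\<close> \<open>\<sigma> > 1 / 2\<close>])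
      finally show "\<exists>E'. ((\<lambda>s. P_norm_sq P (u s)) has_real_derivative E') (at t) \<and>
          E' \<le> a * (g t)\<^sup>2 * (\<sigma>\<^sup>2 / (2 * \<sigma> - 1))"
        using deriv by blast
    qed
  }
qed

end
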